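(* Let $N\ge1$ be an integer, let $0\le a<b$, and let $x_1,\ldots,x_N$ be distinct positive real numbers contained in $(a,b)$. Let $g$ be a continuous real-valued function defined on $(a,b)$. Let $\epsilon>0$ be small enough that $x_k+\epsilon\in(a,b)$ for all $k$ and that, for every $\epsilon'\in(0,\epsilon]$, the $2N$ numbers $x_1,\ldots,x_N,x_1+\epsilon',\ldots,x_N+\epsilon'$ are distinct. For $i,j\in\{0,1\}$ let $K_{ij}$ be the $N\times N$ matrix $$K_{ij}=\left[\frac{g(x_k+i\epsilon)+g(x_l+j\epsilon)}{(x_k+i\epsilon)+(x_l+j\epsilon)}\right]_{k,l=1}^N,$$ and for $i,j\in\{0,1\}$ with $i\ne j$ let $L_{ij}$ be the $N\times N$ matrix $$L_{ij}=\left[\frac{g(x_k+i\epsilon)-g(x_l+j\epsilon)}{(x_k+i\epsilon)-(x_l+j\epsilon)}\right]_{k,l=1}^N.$$ Then the following are equivalent: 1. the $2N\times 2N$ matrix $\begin{pmatrix} K_{00} & K_{01} \\ K_{10} & K_{11} \end{pmatrix}$ is positive semidefinite; 2. the $2N\times 2N$ matrix $\begin{pmatrix} K_{00} & L_{01} \\ L_{10} & K_{11} \end{pmatrix}$ is positive semidefinite.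
   Context: All matrices are real; $i,j$ are the block indices in $\{0,1\}$ (here $i$ is not the imaginary unit). A real symmetric matrix is positive semidefinite if its quadratic form is non-negative. *)

theory Defs
  imports Complex_Main "Jordan_Normal_Form.Matrix"
begin

definition psd_mat :: "real mat \<Rightarrow> bool" where
  "psd_mat A \<longleftrightarrow> square_mat A \<and> transpose_mat A = A \<and>
     (\<forall>v \<in> carrier_vec (dim_row A). v \<bullet> (A *\<^sub>v v) \<ge> 0)"

text \<open>The points $x_1, \ldots, x_N$ are indexed from 0: they are \<open>x 0, \<dots>, x (N - 1)\<close>.
  The block indices \<open>i\<close>, \<open>j\<close> range over 0 and 1.\<close>

definition K_block ::
    "nat \<Rightarrow> (nat \<Rightarrow> real) \<Rightarrow> (real \<Rightarrow> real) \<Rightarrow> real \<Rightarrow> nat \<Rightarrow> nat \<Rightarrow> real mat" where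
  "K_block N x g \<epsilon> i j = mat N N (\<lambda>(k, l).
     (g (x k + real i * \<epsilon>) + g (x l + real j * \<epsilon>)) /
     ((x k + real i * \<epsilon>) + (x l + real j * \<epsilon>)))"

text \<open>Only meant for \<open>i \<noteq> j\<close>: for \<open>i = j\<close> the diagonal entries are $0/0$, which HOL evaluates to 0.\<close>

definition L_block ::
    "nat \<Rightarrow> (nat \<Rightarrow> real) \<Rightarrow> (real \<Rightarrow> real) \<Rightarrow> real \<Rightarrow> nat \<Rightarrow> nat \<Rightarrow> real mat" where
  "L_block N x g \<epsilon> i j = mat N N (\<lambda>(k, l).
     (g (x k + real i * \<epsilon>) - g (x l + real j * \<epsilon>)) /
     ((x k + real i * \<epsilon>) - (x l + real j * \<epsilon>)))"

end

theory Submission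
  imports Defs
begin

text \<open>
  Both block matrices are instances of the kernel $(h_i + h_j)/(s_i + s_j)$ on $2N$ nodes: negating
  the nodes $x_k + \epsilon$ together with their values turns the off-diagonal blocks $K_{ij}$ into
  $L_{ij}$ and leaves the diagonal blocks unchanged. Negating one node $q = s_m$ and its
  value is a congruence. To find it, represent the node $s$ by the function $1/(s - \zeta)$ and
  multiply the functions by the Blaschke factor $(q + \zeta)/(q - \zeta)$, which is unimodular on
  the imaginary axis; partial fractions of
  $\frac{1}{s - \zeta} \cdot \frac{q + \zeta}{q - \zeta}$ give the coefficients.
\<close>

text \<open>An arbitrary index set lets one node be split off. Symmetry is left to the kernels
  themselves: \<open>pick_kernel s h\<close> is symmetric for all \<open>s\<close> and
  \<open>h\<close>.\<close>

definition psd_kernel :: "'i set \<Rightarrow> ('i \<Rightarrow> 'i \<Rightarrow> real) \<Rightarrow> bool" where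
  "psd_kernel S M \<longleftrightarrow> (\<forall>v. (\<Sum>i\<in>S. \<Sum>j\<in>S. v i * v j * M i j) \<ge> 0)"

definition pick_kernel :: "('i \<Rightarrow> real) \<Rightarrow> ('i \<Rightarrow> real) \<Rightarrow> 'i \<Rightarrow> 'i \<Rightarrow> real" where
  "pick_kernel s h i j = (h i + h j) / (s i + s j)"

definition neg_on :: "'i set \<Rightarrow> ('i \<Rightarrow> real) \<Rightarrow> 'i \<Rightarrow> real" where
  "neg_on A f i = (if i \<in> A then - f i else f i)"

lemma neg_on_neg_on [simp]: "neg_on A (neg_on A f) = f"
  by (simp add: fun_eq_iff neg_on_def)

lemma neg_on_insert: "m \<notin> A \<Longrightarrow> neg_on (insert m A) f = neg_on {m} (neg_on A f)"
  by (auto simp: fun_eq_iff neg_on_def)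

lemma abs_neg_on [simp]: "\<bar>neg_on A f i\<bar> = \<bar>f i\<bar>"
  by (simp add: neg_on_def)

lemma neg_on_eq_0_iff [simp]: "neg_on A f i = 0 \<longleftrightarrow> f i = 0"
  by (simp add: neg_on_def)

text \<open>If both indices or neither are negated, the signs cancel in the quotient; otherwise a
  divided difference remains, the form of the entries of \<open>L_block\<close>. As x / 0 = 0 in
  HOL, no denominator has to be nonzero.\<close>

lemma pick_kernel_neg_on:
  "pick_kernel (neg_on A s) (neg_on A h) i j =
    (if i \<in> A \<longleftrightarrow> j \<in> A then pick_kernel s h i j else (h i - h j) / (s i - s j))"
  using minus_divide_divide[of "h i + h j" "s i + s j"] minus_divide_divide[of "h i - h j" "s i - s j"]
  by (auto simp: pick_kernel_def neg_on_def)

lemma quadratic_form_insert: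
  fixes M :: "'i \<Rightarrow> 'i \<Rightarrow> real"
  assumes "finite T" "m \<notin> T" and sym: "\<And>i j. M i j = M j i"
  shows "(\<Sum>i\<in>insert m T. \<Sum>j\<in>insert m T. v i * v j * M i j) =
    (\<Sum>i\<in>T. \<Sum>j\<in>T. v i * v j * M i j) + 2 * v m * (\<Sum>i\<in>T. v i * M i m) + v m * v m * M m m"
proof -
  have "(\<Sum>j\<in>T. v m * v j * M m j) = v m * (\<Sum>i\<in>T. v i * M i m)"
    by (simp add: sum_distrib_left sym[of m] mult.assoc)
  moreover have "(\<Sum>i\<in>T. v i * v m * M i m) = v m * (\<Sum>i\<in>T. v i * M i m)"
    by (simp add: sum_distrib_left ac_simps)
  ultimately show ?thesis
    using assms(1,2) by (simp add: sum.distrib)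
qed

text \<open>With B(z) = (q + z)/(q - z), partial fractions give B(z)/(s - z) = \<alpha> s/(s - z) +
  \<beta> s/(q - z). The right-hand side is the bilinear expansion of the form on the images of the
  nodes s and t, where u, v, w are the values at s, t, q; the identity says that multiplication by B
  preserves the form.\<close>

lemma pick_kernel_flip:
  fixes s t q u v w :: real
  assumes "s \<noteq> q" "t \<noteq> q" "s + q \<noteq> 0" "t + q \<noteq> 0" "s + t \<noteq> 0" "q \<noteq> 0"
  defines "\<alpha> \<equiv> \<lambda>s. (q + s) / (q - s)" and "\<beta> \<equiv> \<lambda>s. 2 * q / (s - q)"
  shows "(u + v) / (s + t) =
    \<alpha> s * \<alpha> t * ((u + v) / (s + t)) + \<alpha> s * \<beta> t * ((u + w) / (s + q)) +
    \<beta> s * \<alpha> t * ((v + w) / (t + q)) + \<beta> s * \<beta> t * ((w + w) / (q + q))"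
proof -
  have *: "q - s \<noteq> 0" "q - t \<noteq> 0" "q + s \<noteq> 0" "q + t \<noteq> 0"
    using assms by auto
  have \<beta>: "\<beta> s = - 2 * q / (q - s)" "\<beta> t = - 2 * q / (q - t)"
    using minus_divide_right[of "2 * q" "s - q"] minus_divide_right[of "2 * q" "t - q"]
    by (simp_all add: \<beta>_def)
  have 1: "\<alpha> s * \<beta> t * ((u + w) / (s + q)) = - 2 * q * (u + w) / ((q - s) * (q - t))"
    using * by (simp add: \<alpha>_def \<beta> add.commute[of s q])
  have 2: "\<beta> s * \<alpha> t * ((v + w) / (t + q)) = - 2 * q * (v + w) / ((q - s) * (q - t))"
    using * by (simp add: \<alpha>_def \<beta> add.commute[of t q])
  have 3: "\<beta> s * \<beta> t * ((w + w) / (q + q)) = 4 * q * w / ((q - s) * (q - t))"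
    using assms(6) by (simp add: \<beta> divide_simps)
  have frac: "z \<noteq> 0 \<Longrightarrow> (1 + c * z / d) * (y / z) = y / z + c * y / d" for c d y z :: real
    by (simp only: distrib_right) simp
  \<comment> \<open>(q + s)(q + t) - (q - s)(q - t) = 2q(s + t), and this factor s + t cancels the
    denominator of the kernel. All four terms then share the denominator (q - s)(q - t), apart from
    the desired (u + v)/(s + t).\<close>
  have "\<alpha> s * \<alpha> t = 1 + 2 * q * (s + t) / ((q - s) * (q - t))"
    using * by (simp add: \<alpha>_def divide_simps) (simp add: algebra_simps)
  then have 4: "\<alpha> s * \<alpha> t * ((u + v) / (s + t)) =
      (u + v) / (s + t) + 2 * q * (u + v) / ((q - s) * (q - t))"
    by (simp only: frac[OF assms(5)])
  have "2 * q * (u + v) + - 2 * q * (u + w) + - 2 * q * (v + w) + 4 * q * w = 0"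
    by (simp add: algebra_simps)
  then have "(2 * q * (u + v) + - 2 * q * (u + w) + - 2 * q * (v + w) + 4 * q * w) /
      ((q - s) * (q - t)) = 0"
    by simp
  then show ?thesis
    unfolding 1 2 3 4 add_divide_distrib[of _ _ "(q - s) * (q - t)"] by linarith
qed

text \<open>For each v there is a w, linear in v, at which the old form takes the value of the new
  form at v.\<close>

lemma psd_pick_kernel_flip_one:
  assumes "finite S" "m \<in> S"
    and inj: "inj_on (\<lambda>i. \<bar>s i\<bar>) S" and nz: "\<And>i. i \<in> S \<Longrightarrow> s i \<noteq> 0"
    and psd: "psd_kernel S (pick_kernel s h)"
  shows "psd_kernel S (pick_kernel (neg_on {m} s) (neg_on {m} h))"
  unfolding psd_kernel_def
proof
  fix v :: "'a \<Rightarrow> real"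
  define T where "T = S - {m}"
  have S: "S = insert m T" and T: "finite T" "m \<notin> T"
    using assms(1,2) by (auto simp: T_def)
  define q where "q = s m"
  define M where "M = pick_kernel s h"
  define M' where "M' = pick_kernel (neg_on {m} s) (neg_on {m} h)"
  define \<alpha> where "\<alpha> i = (q + s i) / (q - s i)" for i
  define \<beta> where "\<beta> i = 2 * q / (s i - q)" for i
  define X where "X = (\<Sum>i\<in>T. \<beta> i * v i)"
  define Y where "Y = (\<Sum>i\<in>T. \<alpha> i * v i * M i m)"
  \<comment> \<open>The flipped node -q has the function 1/(-q - z), which B sends to -1/(q - z):
    hence the coefficient -1 of \<open>v m\<close>. \<open>X\<close> collects the contributions
    \<beta> of the other nodes to 1/(q - z).\<close>
  define w where "w i = (if i = m then X - v m else \<alpha> i * v i)" for i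
  have sym: "M i j = M j i" "M' i j = M' j i" for i j
    by (simp_all add: M_def M'_def pick_kernel_def add.commute)
  \<comment> \<open>Distinct absolute values exclude both s i = - s j (here) and s i = s j (in
    \<open>neq\<close>); nonzero nodes cover the case i = j.\<close>
  have plus: "s i + s j \<noteq> 0" if "i \<in> S" "j \<in> S" for i j
  proof (cases "i = j")
    case True
    then show ?thesis using nz[OF that(1)] by simp
  next
    case False
    then have "\<bar>s i\<bar> \<noteq> \<bar>s j\<bar>" using inj_onD[OF inj, of i j] that by auto
    then show ?thesis by linarith
  qed
  have neq: "s i \<noteq> q" if "i \<in> T" for i
    using inj_onD[OF inj, of i m] that assms(2) by (auto simp: T_def q_def)
  have q: "q \<noteq> 0" using nz assms(2) by (simp add: q_def)
  have m1: "M' m m = M m m"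
    by (simp add: M_def M'_def pick_kernel_def neg_on_def divide_simps)
  have m2: "M' i m = - (\<alpha> i * M i m + \<beta> i * M m m)" if "i \<in> T" for i
  proof -
    have i: "i \<noteq> m" "q - s i \<noteq> 0" "s i - q \<noteq> 0" "s i + q \<noteq> 0" "q + s i \<noteq> 0"
      using that T neq[OF that] plus[of i m] plus[of m i] S by (auto simp: q_def)
    have "\<alpha> i * M i m = - (h i + h m) / (s i - q)"
      using i by (simp add: \<alpha>_def M_def pick_kernel_def q_def[symmetric] divide_simps)
        (simp add: algebra_simps)
    moreover have "\<beta> i * M m m = 2 * h m / (s i - q)"
      using i q by (simp add: \<beta>_def M_def pick_kernel_def q_def[symmetric] divide_simps)
    moreover have "M' i m = (h i - h m) / (s i - q)"
      using i by (simp add: M'_def pick_kernel_def neg_on_def q_def)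
    ultimately show ?thesis
      by (simp add: add_divide_distrib diff_divide_distrib)
  qed
  have m3: "M' i j = \<alpha> i * \<alpha> j * M i j + \<alpha> i * \<beta> j * M i m + \<beta> i * \<alpha> j * M j m + \<beta> i * \<beta> j * M m m"
    if "i \<in> T" "j \<in> T" for i j
  proof -
    have "i \<noteq> m" "j \<noteq> m" using that T by auto
    then have "M' i j = M i j" by (simp add: M_def M'_def pick_kernel_def neg_on_def)
    moreover have "M i j = \<alpha> i * \<alpha> j * M i j + \<alpha> i * \<beta> j * M i m + \<beta> i * \<alpha> j * M j m + \<beta> i * \<beta> j * M m m"
      unfolding \<alpha>_def \<beta>_def M_def pick_kernel_def q_def[symmetric]
      by (rule pick_kernel_flip) (use neq that q plus S in \<open>auto simp: q_def\<close>)
    ultimately show ?thesis by simp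
  qed
  have wT: "w i = \<alpha> i * v i" if "i \<in> T" for i using that T by (auto simp: w_def)
  have "(\<Sum>i\<in>T. \<Sum>j\<in>T. v i * v j * M' i j) =
     (\<Sum>i\<in>T. \<Sum>j\<in>T. w i * w j * M i j + (\<alpha> i * v i * M i m) * (\<beta> j * v j) +
        (\<beta> i * v i) * (\<alpha> j * v j * M j m) + (\<beta> i * v i) * (\<beta> j * v j) * M m m)"
    by (intro sum.cong refl) (simp add: m3 wT algebra_simps)
  also have "\<dots> = (\<Sum>i\<in>T. \<Sum>j\<in>T. w i * w j * M i j) + Y * X + X * Y + X * X * M m m"
    by (simp add: sum.distrib X_def Y_def sum_product sum_distrib_right[symmetric])
  finally have 1: "(\<Sum>i\<in>T. \<Sum>j\<in>T. v i * v j * M' i j) =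
    (\<Sum>i\<in>T. \<Sum>j\<in>T. w i * w j * M i j) + Y * X + X * Y + X * X * M m m" .
  have "(\<Sum>i\<in>T. v i * M' i m) = (\<Sum>i\<in>T. - (\<alpha> i * v i * M i m) - (\<beta> i * v i) * M m m)"
    by (intro sum.cong refl) (simp add: m2 algebra_simps)
  then have 2: "(\<Sum>i\<in>T. v i * M' i m) = - Y - X * M m m"
    by (simp add: sum_subtractf sum_negf X_def Y_def sum_distrib_right)
  have 3: "(\<Sum>i\<in>T. w i * M i m) = Y"
    unfolding Y_def by (intro sum.cong refl) (simp add: wT)
  have wm: "w m = X - v m" by (simp add: w_def)
  \<comment> \<open>Apart from the common sum over \<open>T\<close>, both sides equal 2 (X - v m) Y
    + (X - v m)^2 M m m.\<close>
  have "(\<Sum>i\<in>S. \<Sum>j\<in>S. v i * v j * M' i j) = (\<Sum>i\<in>S. \<Sum>j\<in>S. w i * w j * M i j)"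
    unfolding S quadratic_form_insert[of T m M, OF T sym(1)]
      quadratic_form_insert[of T m M', OF T sym(2)] 1 2 3 m1 wm
    by (simp add: algebra_simps)
  also have "\<dots> \<ge> 0" using psd by (simp add: psd_kernel_def M_def)
  finally show "(\<Sum>i\<in>S. \<Sum>j\<in>S. v i * v j * pick_kernel (neg_on {m} s) (neg_on {m} h) i j) \<ge> 0"
    by (simp add: M'_def)
qed

text \<open>The conditions on the nodes depend only on their absolute values, so they survive each
  flip and the nodes of \<open>A\<close> can be flipped one at a time.\<close>

lemma psd_pick_kernel_flip:
  assumes "finite S" "A \<subseteq> S"
    and "inj_on (\<lambda>i. \<bar>s i\<bar>) S" "\<And>i. i \<in> S \<Longrightarrow> s i \<noteq> 0"
    and "psd_kernel S (pick_kernel s h)"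
  shows "psd_kernel S (pick_kernel (neg_on A s) (neg_on A h))"
  using finite_subset[OF assms(2,1)] assms(2)
proof (induction A rule: finite_induct)
  case empty
  then show ?case using assms(5) by (simp add: neg_on_def[abs_def])
next
  case (insert m A)
  then show ?case
    using psd_pick_kernel_flip_one[of S m "neg_on A s" "neg_on A h"] assms
    by (simp add: neg_on_insert[OF insert.hyps(2)])
qed

text \<open>Flipping is an involution, so the converse is the same implication applied to the
  flipped data.\<close>

corollary psd_pick_kernel_flip_iff:
  assumes "finite S" "A \<subseteq> S"
    and "inj_on (\<lambda>i. \<bar>s i\<bar>) S" "\<And>i. i \<in> S \<Longrightarrow> s i \<noteq> 0"
  shows "psd_kernel S (pick_kernel (neg_on A s) (neg_on A h)) \<longleftrightarrow> psd_kernel S (pick_kernel s h)"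
  using psd_pick_kernel_flip[OF assms] psd_pick_kernel_flip[of S A "neg_on A s" "neg_on A h"] assms
  by auto

lemma psd_mat_iff_psd_kernel:
  assumes "\<And>i j. M i j = M j i"
  shows "psd_mat (mat n n (\<lambda>(i, j). M i j)) \<longleftrightarrow> psd_kernel {0..<n} M"
proof -
  let ?A = "mat n n (\<lambda>(i, j). M i j)"
  have form: "v \<bullet> (?A *\<^sub>v v) = (\<Sum>i = 0..<n. \<Sum>j = 0..<n. v $ i * v $ j * M i j)"
    if "v \<in> carrier_vec n" for v
    using that by (simp add: scalar_prod_def sum_distrib_left ac_simps)
  have "transpose_mat ?A = ?A" using assms by (intro eq_matI) auto
  then have "psd_mat ?A \<longleftrightarrow>
      (\<forall>v\<in>carrier_vec n. (\<Sum>i = 0..<n. \<Sum>j = 0..<n. v $ i * v $ j * M i j) \<ge> 0)"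
    by (simp add: psd_mat_def form)
  also have "\<dots> \<longleftrightarrow> psd_kernel {0..<n} M"
    unfolding psd_kernel_def
  proof (intro iffI allI ballI)
    fix v :: "nat \<Rightarrow> real"
    assume "\<forall>v\<in>carrier_vec n. (\<Sum>i = 0..<n. \<Sum>j = 0..<n. v $ i * v $ j * M i j) \<ge> 0"
    from bspec[OF this, of "vec n v"]
    show "(\<Sum>i = 0..<n. \<Sum>j = 0..<n. v i * v j * M i j) \<ge> 0" by simp
  next
    fix v :: "real vec"
    assume "\<forall>v. (\<Sum>i = 0..<n. \<Sum>j = 0..<n. v i * v j * M i j) \<ge> 0"
    then show "(\<Sum>i = 0..<n. \<Sum>j = 0..<n. v $ i * v $ j * M i j) \<ge> 0"
      by (rule allE[of _ "\<lambda>i. v $ i"])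
  qed
  finally show ?thesis .
qed

theorem theorem2p2:
  fixes N :: nat and a b \<epsilon> :: real and x :: "nat \<Rightarrow> real" and g :: "real \<Rightarrow> real"
  assumes "N \<ge> 1"
    and "0 \<le> a" and "a < b"
    and "distinct (map x [0..<N])"
    and "\<And>k. k < N \<Longrightarrow> 0 < x k"
    and "\<And>k. k < N \<Longrightarrow> x k \<in> {a<..<b}"
    and "continuous_on {a<..<b} g"
    and "\<epsilon> > 0"
    and "\<And>k. k < N \<Longrightarrow> x k + \<epsilon> \<in> {a<..<b}"
    and "\<And>\<epsilon>'. \<epsilon>' \<in> {0<..\<epsilon>} \<Longrightarrow>
           distinct (map x [0..<N] @ map (\<lambda>k. x k + \<epsilon>') [0..<N])"
  shows "psd_mat (four_block_mat (K_block N x g \<epsilon> 0 0) (K_block N x g \<epsilon> 0 1)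
                                 (K_block N x g \<epsilon> 1 0) (K_block N x g \<epsilon> 1 1))
     \<longleftrightarrow> psd_mat (four_block_mat (K_block N x g \<epsilon> 0 0) (L_block N x g \<epsilon> 0 1)
                                 (L_block N x g \<epsilon> 1 0) (K_block N x g \<epsilon> 1 1))"
proof -
  define s where "s i = (if i < N then x i else x (i - N) + \<epsilon>)" for i
  define h where "h i = g (s i)" for i
  \<comment> \<open>\<open>A\<close> indexes the shifted nodes, so exactly the two off-diagonal
    blocks pair an index in \<open>A\<close> with one outside.\<close>
  define A where "A = {N..<N + N}"
  have pos: "s i > 0" if "i \<in> {0..<N + N}" for i
    using that assms(5)[of i] assms(5)[of "i - N"] assms(8) by (auto simp: s_def add_pos_pos)
  have "distinct (map x [0..<N] @ map (\<lambda>k. x k + \<epsilon>) [0..<N])"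
    using assms(8) by (intro assms(10)) simp
  also have "map x [0..<N] @ map (\<lambda>k. x k + \<epsilon>) [0..<N] = map s [0..<N + N]"
    by (rule nth_equalityI) (auto simp: s_def nth_append)
  finally have "inj_on s {0..<N + N}" by (simp add: distinct_map)
  \<comment> \<open>Positivity of the nodes turns their distinctness, the case \<epsilon>' =
    \<epsilon> of the hypothesis, into distinctness of absolute values.\<close>
  moreover have "inj_on (\<lambda>i. \<bar>s i\<bar>) {0..<N + N} \<longleftrightarrow> inj_on s {0..<N + N}"
    using pos by (intro inj_on_cong) (simp add: abs_of_pos)
  ultimately have inj: "inj_on (\<lambda>i. \<bar>s i\<bar>) {0..<N + N}" by simp
  have K: "four_block_mat (K_block N x g \<epsilon> 0 0) (K_block N x g \<epsilon> 0 1)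
      (K_block N x g \<epsilon> 1 0) (K_block N x g \<epsilon> 1 1) =
      mat (N + N) (N + N) (\<lambda>(i, j). pick_kernel s h i j)"
    by (rule eq_matI) (auto simp: K_block_def pick_kernel_def h_def s_def)
  have L: "four_block_mat (K_block N x g \<epsilon> 0 0) (L_block N x g \<epsilon> 0 1)
      (L_block N x g \<epsilon> 1 0) (K_block N x g \<epsilon> 1 1) =
      mat (N + N) (N + N) (\<lambda>(i, j). pick_kernel (neg_on A s) (neg_on A h) i j)"
    unfolding pick_kernel_neg_on
    by (rule eq_matI)
      (auto simp: K_block_def L_block_def pick_kernel_def A_def h_def s_def)
  have sym: "pick_kernel s h i j = pick_kernel s h j i" for s h :: "nat \<Rightarrow> real" and i j
    by (simp add: pick_kernel_def add.commute)
  show ?thesis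
    unfolding K L psd_mat_iff_psd_kernel[OF sym]
    by (rule psd_pick_kernel_flip_iff[symmetric, OF _ _ inj])
      (use pos in \<open>auto simp: A_def less_imp_neq[symmetric]\<close>)
qed

end
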